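(* Let $d:\mathbb{R}\to\mathbb{R}$ be an arbitrary function. Then the following three assertions hold. (i) Let $n,m,k\in\mathbb{N}$, $f\in\mathscr{A}_n^m$ and $g\in\mathscr{A}_m^k$. If $d$ is a derivation with respect to $f$ and with respect to $g$, then $d$ is also a derivation with respect to $g\circ f$. (ii) Let $n,m,k\in\mathbb{N}$, $f\in\mathscr{A}_n^m$ and $g\in\mathscr{A}_m^k$ be such that $f(\mathrm{dom}_f)$ is open. If $d$ is a derivation with respect to $f$ and with respect to $g\circ f$, then $d$ is also a derivation with respect to $g$ on $f(\mathrm{dom}_f)\cap\mathrm{dom}_g$. (iii) Let $n\in\mathbb{N}$ and let $f\in\mathscr{A}_n^n$ be an injective function with a continuous and nowhere singular derivative. If $d$ is a derivation with respect to $f$, then $d$ is also a derivation with respect to its inverse $f^{-1}$ (defined on $f(\mathrm{dom}_f)$).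
   Context: For $n,m\in\mathbb{N}$, $\mathscr{A}_n^m$ denotes the class of all functions $f:\Omega\to\mathbb{R}^m$ where $\Omega\subseteq\mathbb{R}^n$ is a nonempty open set and $f$ is Fréchet differentiable on $\Omega$; the set $\Omega$ is denoted $\mathrm{dom}_f$. For $x\in\mathbb{R}^n$, $x_i$ is its $i$th coordinate, and $f_j$ is the $j$th coordinate function of $f$. A function $d:\mathbb{R}\to\mathbb{R}$ is called a derivation with respect to $f\in\mathscr{A}_n^m$ if for all $x\in\mathrm{dom}_f$ and all $j\in\{1,\dots,m\}$, $$d(f_j(x))=\partial_1 f_j(x)\,d(x_1)+\dots+\partial_n f_j(x)\,d(x_n).$$ It is a derivation with respect to $f$ on a set $S\subseteq\mathrm{dom}_f$ if this identity holds for all $x\in S$ and all $j$. The composition $g\circ f$ is defined on $\{x\in\mathrm{dom}_f : f(x)\in\mathrm{dom}_g\}$. *)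

theory Defs
  imports "HOL-Analysis.Analysis"
begin

(* A partial function with domain \<Omega> is represented by \<Omega> together with a total function f whose
   values outside \<Omega> are irrelevant: \<Omega> is open, so differentiability and the partial derivatives
   at points of \<Omega> depend only on the restriction of f to \<Omega>. *)

definition frechet_class :: "(real^'n) set \<Rightarrow> (real^'n \<Rightarrow> real^'m) \<Rightarrow> bool" where
  "frechet_class \<Omega> f \<longleftrightarrow>
     \<Omega> \<noteq> {} \<and> open \<Omega> \<and> (\<forall>x\<in>\<Omega>. f differentiable (at x))"

definition partial_deriv :: "'n \<Rightarrow> (real^'n \<Rightarrow> real) \<Rightarrow> real^'n \<Rightarrow> real" where
  "partial_deriv i h x = deriv (\<lambda>t. h (x + t *\<^sub>R axis i 1)) 0"

(* For f with domain \<Omega>, being a derivation with respect to f is the case S = \<Omega>. *)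

definition derivation_on :: "(real \<Rightarrow> real) \<Rightarrow> (real^'n \<Rightarrow> real^'m) \<Rightarrow> (real^'n) set \<Rightarrow> bool" where
  "derivation_on d f S \<longleftrightarrow>
     (\<forall>x\<in>S. \<forall>j. d (f x $ j) = (\<Sum>i\<in>UNIV. partial_deriv i (\<lambda>y. f y $ j) x * d (x $ i)))"

end

theory Submission
  imports Defs
begin

text \<open>
  Writing \<open>coordinatewise d x\<close> for the vector \<open>(d x\<^sub>1, \<dots>, d x\<^sub>n)\<close>, the \<open>m\<close> scalar identities in the
  definition of a derivation with respect to \<open>f\<close> at \<open>x\<close> combine into the single vector equation
    \<open>coordinatewise d (f x) = Df(x) (coordinatewise d x)\<close>,
  because the total derivative \<open>Df(x)\<close> is the linear map whose matrix consists of the partial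
  derivatives (lemma \<open>derivation_on_iff\<close>). So \<open>d\<close> is a derivation with respect to \<open>f\<close> exactly when
  the pair \<open>(x, coordinatewise d x)\<close> is mapped to \<open>(f x, coordinatewise d (f x))\<close> by the tangent map
  \<open>(x, v) \<mapsto> (f x, Df(x) v)\<close>. By the chain rule the tangent map is a functor, and this gives all
  three assertions: for a composition two such equations are chained. The second assertion cancels
  the equation for \<open>f\<close> from the one for \<open>g \<circ> f\<close> at any preimage of the given point. The third
  one applies \<open>Df(x)\<inverse>\<close>, the derivative of the inverse function at \<open>f x\<close>, to both sides of
  the equation. Here the domain of the inverse function is open by
  invariance of domain, and its differentiability is the inverse function theorem.
\<close>

definition coordinatewise :: "(real \<Rightarrow> real) \<Rightarrow> real^'n \<Rightarrow> real^'n" where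
  "coordinatewise d x = (\<chi> i. d (x $ i))"

lemma coordinatewise_nth [simp]: "coordinatewise d x $ i = d (x $ i)"
  by (simp add: coordinatewise_def)

lemma partial_deriv_component:
  fixes f :: "real^'n \<Rightarrow> real^'m"
  assumes "(f has_derivative f') (at x)"
  shows "partial_deriv i (\<lambda>y. f y $ j) x = f' (axis i 1) $ j"
proof -
  have line: "((\<lambda>t. x + t *\<^sub>R axis i 1) has_derivative (\<lambda>t. t *\<^sub>R axis i 1)) (at (0::real))"
    by (auto intro!: derivative_eq_intros)
  have "(f has_derivative f') (at (x + 0 *\<^sub>R axis i 1))"
    using assms by simp
  from diff_chain_at[OF line this]
  have "((\<lambda>t. f (x + t *\<^sub>R axis i 1)) has_derivative (\<lambda>t. f' (t *\<^sub>R axis i 1))) (at 0)"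
    by (simp add: o_def)
  then have "((\<lambda>t. f (x + t *\<^sub>R axis i 1) $ j) has_derivative (\<lambda>t. f' (t *\<^sub>R axis i 1) $ j)) (at 0)"
    by (rule bounded_linear.has_derivative[OF bounded_linear_vec_nth])
  moreover have "(\<lambda>t. f' (t *\<^sub>R axis i 1) $ j) = (*) (f' (axis i 1) $ j)"
    using has_derivative_linear[OF assms] by (auto simp: linear_cmul mult.commute)
  ultimately have "((\<lambda>t. f (x + t *\<^sub>R axis i 1) $ j) has_field_derivative f' (axis i 1) $ j) (at 0)"
    by (simp add: has_field_derivative_def)
  then show ?thesis
    unfolding partial_deriv_def by (rule DERIV_imp_deriv)
qed

lemma linear_nth_axis_expansion:
  fixes f' :: "real^'n \<Rightarrow> real^'m"
  assumes "linear f'"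
  shows "f' v $ j = (\<Sum>i\<in>UNIV. f' (axis i 1) $ j * v $ i)"
proof -
  have "f' v = f' (\<Sum>i\<in>UNIV. v $ i *\<^sub>R axis i 1)"
    using basis_expansion[of v] by (simp add: scalar_mult_eq_scaleR)
  also have "\<dots> = (\<Sum>i\<in>UNIV. v $ i *\<^sub>R f' (axis i 1))"
    using assms by (simp add: linear_sum linear_cmul)
  finally show ?thesis
    by (simp add: mult.commute)
qed

text \<open>
  Freed from coordinates, the derivation property says that \<open>coordinatewise d\<close> intertwines \<open>f\<close> with
  its total derivative; in this form it can be combined with the chain rule.
\<close>

lemma derivation_on_iff:
  fixes f :: "real^'n \<Rightarrow> real^'m"
  assumes "\<And>x. x \<in> S \<Longrightarrow> (f has_derivative F x) (at x)"
  shows "derivation_on d f S \<longleftrightarrow>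
    (\<forall>x\<in>S. coordinatewise d (f x) = F x (coordinatewise d x))"
proof -
  have "(\<Sum>i\<in>UNIV. partial_deriv i (\<lambda>y. f y $ j) x * d (x $ i)) = F x (coordinatewise d x) $ j"
    if "x \<in> S" for x j
    using linear_nth_axis_expansion[OF has_derivative_linear[OF assms[OF that]],
        of "coordinatewise d x" j]
    by (simp add: partial_deriv_component[OF assms[OF that]])
  then show ?thesis
    by (auto simp: derivation_on_def vec_eq_iff)
qed

lemma frechet_class_has_derivative:
  assumes "frechet_class \<Omega> f" "x \<in> \<Omega>"
  shows "(f has_derivative frechet_derivative f (at x)) (at x)"
  using assms by (simp add: frechet_class_def frechet_derivative_works)

lemma frechet_class_continuous_on:
  assumes "frechet_class \<Omega> f"
  shows "continuous_on \<Omega> f"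
  using assms
  by (auto simp: frechet_class_def intro!: continuous_at_imp_continuous_on
      differentiable_imp_continuous_within)

lemma frechet_class_compose:
  fixes f :: "real^'n \<Rightarrow> real^'m" and g :: "real^'m \<Rightarrow> real^'k"
  assumes f: "frechet_class \<Omega> f" and g: "frechet_class \<Theta> g" and "{x\<in>\<Omega>. f x \<in> \<Theta>} \<noteq> {}"
  shows "frechet_class {x\<in>\<Omega>. f x \<in> \<Theta>} (g \<circ> f)"
proof -
  have "open (\<Omega> \<inter> f -` \<Theta>)"
    using f g frechet_class_continuous_on[OF f]
    by (intro continuous_open_preimage) (auto simp: frechet_class_def)
  moreover have "\<Omega> \<inter> f -` \<Theta> = {x\<in>\<Omega>. f x \<in> \<Theta>}"
    by auto
  ultimately show ?thesis
    using assms by (auto simp: frechet_class_def intro: differentiable_chain_at)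
qed

text \<open>
  By the chain rule, the property of \<open>g \<circ> f\<close> at \<open>x\<close> equates \<open>coordinatewise d (g (f x))\<close> with
  \<open>Dg(f x) (Df(x) (coordinatewise d x))\<close>. The property of \<open>f\<close> at \<open>x\<close> turns the inner
  term into \<open>coordinatewise d (f x)\<close>, and what is left is the property of \<open>g\<close> at \<open>f x\<close>. Each
  direction of the equivalence gives one of the two assertions on compositions.
\<close>

lemma derivation_on_compose_iff:
  fixes f :: "real^'n \<Rightarrow> real^'m" and g :: "real^'m \<Rightarrow> real^'k"
  assumes f: "frechet_class \<Omega> f" and g: "frechet_class \<Theta> g" and df: "derivation_on d f \<Omega>"
  shows "derivation_on d (g \<circ> f) {x\<in>\<Omega>. f x \<in> \<Theta>} \<longleftrightarrow> derivation_on d g (f ` \<Omega> \<inter> \<Theta>)"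
proof -
  let ?F = "\<lambda>x. frechet_derivative f (at x)" and ?G = "\<lambda>y. frechet_derivative g (at y)"
  have F: "(f has_derivative ?F x) (at x)" if "x \<in> \<Omega>" for x
    by (rule frechet_class_has_derivative[OF f that])
  have G: "(g has_derivative ?G y) (at y)" if "y \<in> \<Theta>" for y
    by (rule frechet_class_has_derivative[OF g that])
  have GF: "((g \<circ> f) has_derivative (?G (f x) \<circ> ?F x)) (at x)" if "x \<in> {x\<in>\<Omega>. f x \<in> \<Theta>}" for x
    using that by (intro diff_chain_at F G) auto
  have "coordinatewise d (f x) = ?F x (coordinatewise d x)" if "x \<in> \<Omega>" for x
    using df that derivation_on_iff[where F = ?F, OF F] by blast
  then have "derivation_on d (g \<circ> f) {x\<in>\<Omega>. f x \<in> \<Theta>} \<longleftrightarrow>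
      (\<forall>x\<in>\<Omega>. f x \<in> \<Theta> \<longrightarrow> coordinatewise d (g (f x)) = ?G (f x) (coordinatewise d (f x)))"
    using derivation_on_iff[where S = "{x\<in>\<Omega>. f x \<in> \<Theta>}" and F = "\<lambda>x. ?G (f x) \<circ> ?F x", OF GF]
    by auto
  also have "\<dots> \<longleftrightarrow> derivation_on d g (f ` \<Omega> \<inter> \<Theta>)"
    using derivation_on_iff[where S = "f ` \<Omega> \<inter> \<Theta>" and F = ?G, OF G] by auto
  finally show ?thesis .
qed

lemma derivation_on_subset:
  "derivation_on d f S \<Longrightarrow> T \<subseteq> S \<Longrightarrow> derivation_on d f T"
  by (auto simp: derivation_on_def)

lemma matrix_inv_mul:
  fixes A :: "'a::semiring_1^'n^'m"
  assumes "invertible A"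
  shows matrix_inv_right: "A ** matrix_inv A = mat 1"
    and matrix_inv_left: "matrix_inv A ** A = mat 1"
  using someI_ex[OF assms[unfolded invertible_def]] by (auto simp: matrix_inv_def)

text \<open>
  At a point where the Jacobian matrix is invertible, its inverse matrix represents the derivative
  of a local inverse. Global injectivity makes \<open>inv_into \<Omega> f\<close> a left inverse on all of \<open>\<Omega>\<close>,
  so the local inverse at each point is the restriction of one and the same function.
\<close>

lemma has_derivative_inv_into:
  fixes f :: "real^'n \<Rightarrow> real^'n"
  assumes f: "frechet_class \<Omega> f" and inj: "inj_on f \<Omega>" and x: "x \<in> \<Omega>"
    and inv: "invertible (jacobian f (at x))"
  shows "(inv_into \<Omega> f has_derivative (*v) (matrix_inv (jacobian f (at x)))) (at (f x))"
proof (rule has_derivative_inverse_strong[where f = f and x = x])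
  show "open \<Omega>" "x \<in> \<Omega>"
    using f x by (auto simp: frechet_class_def)
  show "continuous_on \<Omega> f"
    by (rule frechet_class_continuous_on[OF f])
  show "inv_into \<Omega> f (f y) = y" if "y \<in> \<Omega>" for y
    using inj that by simp
  show "(f has_derivative (*v) (jacobian f (at x))) (at x)"
    using f x jacobian_works by (auto simp: frechet_class_def)
  show "(*v) (jacobian f (at x)) \<circ> (*v) (matrix_inv (jacobian f (at x))) = id"
    using matrix_inv_right[OF inv] by (auto simp: fun_eq_iff matrix_vector_mul_assoc)
qed

lemma frechet_class_inv_into:
  fixes f :: "real^'n \<Rightarrow> real^'n"
  assumes f: "frechet_class \<Omega> f" and inj: "inj_on f \<Omega>"
    and inv: "\<And>x. x \<in> \<Omega> \<Longrightarrow> invertible (jacobian f (at x))"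
  shows "frechet_class (f ` \<Omega>) (inv_into \<Omega> f)"
proof -
  have "open (f ` \<Omega>)"
    using f inj by (intro invariance_of_domain frechet_class_continuous_on)
      (auto simp: frechet_class_def)
  moreover have "inv_into \<Omega> f differentiable (at (f x))" if "x \<in> \<Omega>" for x
    using has_derivative_inv_into[OF f inj that inv[OF that]] by (rule differentiableI)
  ultimately show ?thesis
    using f by (auto simp: frechet_class_def)
qed

lemma derivation_on_inv_into:
  fixes f :: "real^'n \<Rightarrow> real^'n"
  assumes f: "frechet_class \<Omega> f" and inj: "inj_on f \<Omega>"
    and inv: "\<And>x. x \<in> \<Omega> \<Longrightarrow> invertible (jacobian f (at x))"
    and df: "derivation_on d f \<Omega>"
  shows "derivation_on d (inv_into \<Omega> f) (f ` \<Omega>)"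
proof -
  let ?J = "\<lambda>x. jacobian f (at x)" and ?g = "inv_into \<Omega> f"
  have F: "(f has_derivative (*v) (?J x)) (at x)" if "x \<in> \<Omega>" for x
    using f that jacobian_works by (auto simp: frechet_class_def)
  have G: "(?g has_derivative (*v) (matrix_inv (?J (?g y)))) (at y)" if "y \<in> f ` \<Omega>" for y
    using that has_derivative_inv_into[OF f inj _ inv] inj by auto
  have "coordinatewise d x = matrix_inv (?J x) *v coordinatewise d (f x)" if x: "x \<in> \<Omega>" for x
  proof -
    have "coordinatewise d (f x) = ?J x *v coordinatewise d x"
      using df x derivation_on_iff[where F = "\<lambda>x. (*v) (?J x)", OF F] by blast
    then show ?thesis
      using matrix_inv_left[OF inv[OF x]] by (simp add: matrix_vector_mul_assoc)
  qed
  then show ?thesis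
    using derivation_on_iff[where F = "\<lambda>y. (*v) (matrix_inv (?J (?g y)))", OF G] inj by auto
qed

theorem theorem1:
  fixes d :: "real \<Rightarrow> real"
  shows
    "(\<forall>\<Omega> (f :: real^'n \<Rightarrow> real^'m) \<Theta> (g :: real^'m \<Rightarrow> real^'k).
        frechet_class \<Omega> f \<longrightarrow> frechet_class \<Theta> g \<longrightarrow>
        derivation_on d f \<Omega> \<longrightarrow> derivation_on d g \<Theta> \<longrightarrow>
          ({x\<in>\<Omega>. f x \<in> \<Theta>} \<noteq> {} \<longrightarrow> frechet_class {x\<in>\<Omega>. f x \<in> \<Theta>} (g \<circ> f)) \<and>
          derivation_on d (g \<circ> f) {x\<in>\<Omega>. f x \<in> \<Theta>}) \<and>
     (\<forall>\<Omega> (f :: real^'n \<Rightarrow> real^'m) \<Theta> (g :: real^'m \<Rightarrow> real^'k).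
        frechet_class \<Omega> f \<longrightarrow> frechet_class \<Theta> g \<longrightarrow> open (f ` \<Omega>) \<longrightarrow>
        derivation_on d f \<Omega> \<longrightarrow> derivation_on d (g \<circ> f) {x\<in>\<Omega>. f x \<in> \<Theta>} \<longrightarrow>
          derivation_on d g (f ` \<Omega> \<inter> \<Theta>)) \<and>
     (\<forall>\<Omega> (f :: real^'n \<Rightarrow> real^'n).
        frechet_class \<Omega> f \<longrightarrow> inj_on f \<Omega> \<longrightarrow>
        continuous_on \<Omega> (\<lambda>x. jacobian f (at x)) \<longrightarrow>
        (\<forall>x\<in>\<Omega>. invertible (jacobian f (at x))) \<longrightarrow>
        derivation_on d f \<Omega> \<longrightarrow>
          frechet_class (f ` \<Omega>) (inv_into \<Omega> f) \<and>
          derivation_on d (inv_into \<Omega> f) (f ` \<Omega>))"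
proof (intro conjI allI impI)
  fix \<Omega> \<Theta> and f :: "real^'n \<Rightarrow> real^'m" and g :: "real^'m \<Rightarrow> real^'k"
  assume f: "frechet_class \<Omega> f" and g: "frechet_class \<Theta> g" and df: "derivation_on d f \<Omega>"
  show "frechet_class {x\<in>\<Omega>. f x \<in> \<Theta>} (g \<circ> f)" if "{x\<in>\<Omega>. f x \<in> \<Theta>} \<noteq> {}"
    using f g that by (rule frechet_class_compose)
  show "derivation_on d (g \<circ> f) {x\<in>\<Omega>. f x \<in> \<Theta>}" if "derivation_on d g \<Theta>"
    using derivation_on_compose_iff[OF f g df] derivation_on_subset[OF that] by blast
  show "derivation_on d g (f ` \<Omega> \<inter> \<Theta>)" if "derivation_on d (g \<circ> f) {x\<in>\<Omega>. f x \<in> \<Theta>}"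
    using derivation_on_compose_iff[OF f g df] that by blast
next
  fix \<Omega> and f :: "real^'n \<Rightarrow> real^'n"
  assume "frechet_class \<Omega> f" "inj_on f \<Omega>" "\<forall>x\<in>\<Omega>. invertible (jacobian f (at x))"
    and df: "derivation_on d f \<Omega>"
  then show "frechet_class (f ` \<Omega>) (inv_into \<Omega> f)" "derivation_on d (inv_into \<Omega> f) (f ` \<Omega>)"
    by (auto intro: frechet_class_inv_into derivation_on_inv_into)
qed

end
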